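(* Let $f\in\mathcal B$ and let $(a_n)_{n\ge0}\subset\mathbb H$ be such that $f(q)=\sum_{n=0}^\infty q^na_n$ on $\mathbb B$. Then $$|a_n|\le\frac{e}{\sqrt2}\,\|f\|_{\mathcal B}$$ for any $n\in\mathbb N\cup\{0\}$.
   Context: $\mathbb H$ denotes the quaternions with real part coordinate $x_0$, $\mathbb S^2$ the sphere of purely imaginary unit quaternions, $\mathbb C(i)=\{x+iy:x,y\in\mathbb R\}$ for $i\in\mathbb S^2$, $\mathbb B$ the open unit ball of $\mathbb H$, $\mathbb B_i=\mathbb B\cap\mathbb C(i)$. A real differentiable function $f:\mathbb B\to\mathbb H$ is (left) slice regular if for every $i\in\mathbb S^2$, $\left(\frac{\partial}{\partial x}+i\frac{\partial}{\partial y}\right)f(x+iy)=0$ on $\mathbb B_i$. The slice regular Bloch space $\mathcal B$ is the space of slice regular functions $f$ on $\mathbb B$ with $\|f\|_{\mathcal B}:=|f(0)|+\sup_{q\in\mathbb B}(1-|q|^2)\left|\frac{\partial f}{\partial x_0}(q)\right|<\infty$. *)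

theory Defs
  imports "HOL-Analysis.Analysis"
begin

codatatype quat = Quat (q0: real) (q1: real) (q2: real) (q3: real)

lemma quat_eq_iff: "p = q \<longleftrightarrow> q0 p = q0 q \<and> q1 p = q1 q \<and> q2 p = q2 q \<and> q3 p = q3 q"
  by (auto intro: quat.expand)

instantiation quat :: ab_group_add
begin

primcorec zero_quat where
  "q0 0 = 0" | "q1 0 = 0" | "q2 0 = 0" | "q3 0 = 0"

primcorec plus_quat where
  "q0 (p + q) = q0 p + q0 q"
| "q1 (p + q) = q1 p + q1 q"
| "q2 (p + q) = q2 p + q2 q"
| "q3 (p + q) = q3 p + q3 q"

primcorec uminus_quat where
  "q0 (- p) = - q0 p"
| "q1 (- p) = - q1 p"
| "q2 (- p) = - q2 p"
| "q3 (- p) = - q3 p"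

primcorec minus_quat where
  "q0 (p - q) = q0 p - q0 q"
| "q1 (p - q) = q1 p - q1 q"
| "q2 (p - q) = q2 p - q2 q"
| "q3 (p - q) = q3 p - q3 q"

instance
  by standard (simp_all add: quat_eq_iff)

end

instantiation quat :: ring_1
begin

primcorec one_quat where
  "q0 1 = 1" | "q1 1 = 0" | "q2 1 = 0" | "q3 1 = 0"

primcorec times_quat where
  "q0 (p * q) = q0 p * q0 q - q1 p * q1 q - q2 p * q2 q - q3 p * q3 q"
| "q1 (p * q) = q0 p * q1 q + q1 p * q0 q + q2 p * q3 q - q3 p * q2 q"
| "q2 (p * q) = q0 p * q2 q - q1 p * q3 q + q2 p * q0 q + q3 p * q1 q"
| "q3 (p * q) = q0 p * q3 q + q1 p * q2 q - q2 p * q1 q + q3 p * q0 q"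

instance
  by standard (simp_all add: quat_eq_iff algebra_simps)

end

instantiation quat :: real_inner
begin

primcorec scaleR_quat where
  "q0 (scaleR r q) = r * q0 q"
| "q1 (scaleR r q) = r * q1 q"
| "q2 (scaleR r q) = r * q2 q"
| "q3 (scaleR r q) = r * q3 q"

definition inner_quat :: "quat \<Rightarrow> quat \<Rightarrow> real" where
  "inner_quat p q = q0 p * q0 q + q1 p * q1 q + q2 p * q2 q + q3 p * q3 q"

definition norm_quat :: "quat \<Rightarrow> real" where
  "norm_quat q = sqrt ((q0 q)\<^sup>2 + (q1 q)\<^sup>2 + (q2 q)\<^sup>2 + (q3 q)\<^sup>2)"

definition sgn_quat :: "quat \<Rightarrow> quat" where
  "sgn_quat q = scaleR (inverse (norm q)) q"

definition dist_quat :: "quat \<Rightarrow> quat \<Rightarrow> real" where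
  "dist_quat p q = norm (p - q)"

definition uniformity_quat :: "(quat \<times> quat) filter" where
  "uniformity_quat = (INF e\<in>{0 <..}. principal {(p, q). dist p q < e})"

definition open_quat :: "quat set \<Rightarrow> bool" where
  "open_quat U \<longleftrightarrow> (\<forall>x\<in>U. eventually (\<lambda>(x', y). x' = x \<longrightarrow> y \<in> U) uniformity)"

instance
proof
  fix x y z :: quat and r s :: real and U :: "quat set"
  show "r *\<^sub>R (x + y) = r *\<^sub>R x + r *\<^sub>R y"
    and "(r + s) *\<^sub>R x = r *\<^sub>R x + s *\<^sub>R x"
    and "r *\<^sub>R s *\<^sub>R x = (r * s) *\<^sub>R x" and "1 *\<^sub>R x = x"
    by (simp_all add: quat_eq_iff algebra_simps)
  show "dist x y = norm (x - y)" by (rule dist_quat_def)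
  show "sgn x = inverse (norm x) *\<^sub>R x" by (rule sgn_quat_def)
  show "uniformity = (INF e\<in>{0 <..}. principal {(p, q). dist (p::quat) q < e})"
    by (rule uniformity_quat_def)
  show "open U \<longleftrightarrow> (\<forall>x\<in>U. eventually (\<lambda>(x', y). x' = x \<longrightarrow> y \<in> U) uniformity)"
    by (rule open_quat_def)
  show "x \<bullet> y = y \<bullet> x" and "(x + y) \<bullet> z = x \<bullet> z + y \<bullet> z"
    and "(r *\<^sub>R x) \<bullet> y = r * (x \<bullet> y)"
    by (simp_all add: inner_quat_def algebra_simps)
  show "0 \<le> x \<bullet> x" by (simp add: inner_quat_def)
  show "x \<bullet> x = 0 \<longleftrightarrow> x = 0"
    by (simp add: inner_quat_def quat_eq_iff add_nonneg_eq_0_iff)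
  show "norm x = sqrt (x \<bullet> x)"
    by (simp add: norm_quat_def inner_quat_def power2_eq_square)
qed

end

instance quat :: real_normed_algebra_1
proof
  fix x y :: quat and r :: real
  have "norm (x * y) = norm x * norm y"
    unfolding norm_quat_def real_sqrt_mult[symmetric]
    by (rule arg_cong[where f = sqrt]) (simp add: power2_eq_square algebra_simps)
  then show "norm (x * y) \<le> norm x * norm y" by simp
  show "norm (1::quat) = 1" by (simp add: norm_quat_def)
qed (simp_all add: quat_eq_iff algebra_simps)

instantiation quat :: real_normed_div_algebra
begin

definition inverse_quat :: "quat \<Rightarrow> quat" where
  "inverse_quat q = inverse ((norm q)\<^sup>2) *\<^sub>R Quat (q0 q) (- q1 q) (- q2 q) (- q3 q)"

definition divide_quat :: "quat \<Rightarrow> quat \<Rightarrow> quat" where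
  "divide_quat p q = p * inverse q"

instance
proof
  fix x y :: quat
  show "x div y = x * inverse y" by (rule divide_quat_def)
  show "inverse (0::quat) = 0" by (simp add: inverse_quat_def)
  show "norm (x * y) = norm x * norm y"
    unfolding norm_quat_def real_sqrt_mult[symmetric]
    by (rule arg_cong[where f = sqrt]) (simp add: power2_eq_square algebra_simps)
  have n: "(norm x)\<^sup>2 = q0 x * q0 x + q1 x * q1 x + q2 x * q2 x + q3 x * q3 x"
    by (simp add: norm_quat_def power2_eq_square)
  let ?c = "Quat (q0 x) (- q1 x) (- q2 x) (- q3 x)"
  have "x * ?c = (norm x)\<^sup>2 *\<^sub>R 1" and "?c * x = (norm x)\<^sup>2 *\<^sub>R 1"
    by (simp_all add: quat_eq_iff n algebra_simps)
  then show "inverse x * x = 1" and "x * inverse x = 1" if "x \<noteq> 0"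
    using that by (simp_all add: inverse_quat_def)
qed

end

definition imag_units :: "quat set" where
  "imag_units = {i. q0 i = 0 \<and> norm i = 1}"

text \<open>Real differentiability is Frechet differentiability over the reals. The function \<open>f\<close> is
  total, but only its values on the open unit ball matter; as the ball is open, this also holds
  for the derivatives below.\<close>

definition slice_regular :: "(quat \<Rightarrow> quat) \<Rightarrow> bool" where
  "slice_regular f \<longleftrightarrow>
     (\<forall>q\<in>ball 0 1. f differentiable (at q)) \<and>
     (\<forall>i\<in>imag_units. \<forall>x y. of_real x + i * of_real y \<in> ball 0 1 \<longrightarrow>
        vector_derivative (\<lambda>t. f (of_real t + i * of_real y)) (at x) +
        i * vector_derivative (\<lambda>t. f (of_real x + i * of_real t)) (at y) = 0)"

definition deriv_x0 :: "(quat \<Rightarrow> quat) \<Rightarrow> quat \<Rightarrow> quat" where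
  "deriv_x0 f q = vector_derivative (\<lambda>t. f (q + of_real t)) (at 0)"

text \<open>A real supremum is only meaningful for a set that is bounded above, so the finiteness of
  the Bloch norm is stated separately, as boundedness, in the definition of the space.\<close>

definition bloch_norm :: "(quat \<Rightarrow> quat) \<Rightarrow> real" where
  "bloch_norm f = norm (f 0) + (SUP q\<in>ball 0 1. (1 - (norm q)\<^sup>2) * norm (deriv_x0 f q))"

definition bloch_space :: "(quat \<Rightarrow> quat) set" where
  "bloch_space = {f. slice_regular f \<and>
     bdd_above ((\<lambda>q. (1 - (norm q)\<^sup>2) * norm (deriv_x0 f q)) ` ball 0 1)}"

end

theory Submission
  imports Defs "HOL-Complex_Analysis.Complex_Analysis"
begin

text \<open>Restrict \<open>f\<close> to the slice \<open>\<complex>\<close> spanned by \<open>1\<close> and \<open>e\<^sub>1\<close>, multiply on the right by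
  \<open>a\<^sub>n\<^sup>-\<^sup>1\<close> and project \<open>\<real>\<^sup>4 = \<complex> \<oplus> \<complex>e\<^sub>2\<close> to its first summand.
  The projection is left \<open>\<complex>\<close>-linear, so the result is a complex power series \<open>h\<close> whose \<open>n\<close>-th
  coefficient is \<open>1\<close> and whose derivative is at most \<open>M / (\<bar>a\<^sub>n\<bar> (1 - \<bar>z\<bar>\<^sup>2))\<close>, where \<open>M\<close> is the
  Bloch seminorm. Cauchy's estimate for \<open>h'\<close> on the circle of radius \<open>r\<close> with \<open>r\<^sup>2 = 1 - 1/n\<close>
  yields \<open>\<bar>a\<^sub>n\<bar> \<le> \<surd>e M\<close>, and \<open>\<surd>e \<le> e / \<surd>2\<close> because \<open>e \<ge> 2\<close>.\<close>

lemma power_series_deriv_coeff: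
  fixes c :: "nat \<Rightarrow> complex"
  assumes "0 < r" and "\<And>z. z \<in> ball 0 r \<Longrightarrow> (\<lambda>k. c k * z ^ k) sums h z"
  shows "(deriv ^^ n) h 0 = fact n * c n"
proof -
  have "eventually (\<lambda>z. z \<in> ball 0 r) (nhds (0::complex))"
    using \<open>0 < r\<close> by (intro eventually_nhds_in_open) auto
  then have "h has_fps_expansion Abs_fps c"
    by (intro has_fps_expansionI) (auto elim!: eventually_mono intro: assms(2))
  from fps_nth_fps_expansion[OF this, of n] show ?thesis
    by (simp add: field_simps)
qed

text \<open>Cauchy's estimate is applied to \<open>deriv h\<close>, whose \<open>m\<close>-th
  derivative at 0 is \<open>fact (Suc m) * c (Suc m)\<close>; hence the index shift.\<close>

lemma power_series_bloch_coeff_le: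
  fixes c :: "nat \<Rightarrow> complex"
  assumes sums: "\<And>z. z \<in> ball 0 1 \<Longrightarrow> (\<lambda>k. c k * z ^ k) sums h z"
    and bound: "\<And>z. z \<in> ball 0 1 \<Longrightarrow> (1 - (norm z)\<^sup>2) * norm (deriv h z) \<le> M"
  shows "norm (c (Suc m)) \<le> sqrt (exp 1) * M"
proof -
  have M0: "0 \<le> M"
    using bound[of 0] by (auto intro: order_trans[OF norm_ge_zero])
  have coeff: "(deriv ^^ m) (deriv h) 0 = fact (Suc m) * c (Suc m)"
    using power_series_deriv_coeff[of 1 c h "Suc m"] sums
    by (simp add: funpow_Suc_right del: funpow.simps)
  show ?thesis
  proof (cases "m = 0")
    \<comment> \<open>The radius chosen below would degenerate to 0 here; the bound at the centre
      suffices.\<close>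
    case True
    have "norm (c (Suc m)) \<le> 1 * M"
      using coeff bound[of 0] True by simp
    also have "\<dots> \<le> sqrt (exp 1) * M"
      using M0 by (intro mult_right_mono) auto
    finally show ?thesis .
  next
    case False
    \<comment> \<open>This radius makes 1 / (1 - r^2) equal to m + 1, which cancels the quotient of
      \<open>fact (Suc m)\<close> by \<open>fact m\<close>. What remains is r^(-m), the square root
      of (1 + 1/m)^m \<le> e.\<close>
    define r where "r = sqrt (real m / real (Suc m))"
    have r: "0 < r" "r < 1" and r2: "1 - r\<^sup>2 = 1 / real (Suc m)"
      using False by (auto simp: r_def field_simps)
    have "h holomorphic_on ball 0 1"
      using power_series_holomorphic[of 0 1 c h] sums by simp
    then have hol: "deriv h holomorphic_on ball 0 1"
      by (rule holomorphic_deriv) simp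
    have "norm ((deriv ^^ m) (deriv h) 0) \<le> fact m * (M * real (Suc m)) / r ^ m"
    proof (rule Cauchy_inequality)
      show "deriv h holomorphic_on ball 0 r"
        using hol by (rule holomorphic_on_subset) (use r in auto)
      show "continuous_on (cball 0 r) (deriv h)"
        using holomorphic_on_imp_continuous_on[OF hol]
        by (rule continuous_on_subset) (use r in auto)
      show "norm (deriv h z) \<le> M * real (Suc m)" if "norm (0 - z) = r" for z
      proof -
        have "1 / real (Suc m) * norm (deriv h z) \<le> M"
          using bound[of z] that r r2 by simp
        then show ?thesis
          by (simp add: pos_divide_le_eq)
      qed
    qed (use r in auto)
    then have "norm (c (Suc m)) \<le> M * (1 / r) ^ m"
      unfolding coeff using r
      by (simp add: norm_mult norm_of_nat field_simps del: of_nat_Suc)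
    also have "(1 / r) ^ m = sqrt ((1 + 1 / real m) ^ m)"
    proof -
      have "1 / r = sqrt (1 + 1 / real m)"
        using False real_sqrt_inverse[of "real m / real (Suc m)"]
        by (simp add: r_def inverse_eq_divide add_divide_distrib add.commute)
      then show ?thesis
        by (simp add: real_sqrt_power)
    qed
    also have "M * sqrt ((1 + 1 / real m) ^ m) \<le> M * sqrt (exp 1)"
      using exp_ge_one_plus_x_over_n_power_n[of m 1] False M0 by (intro mult_left_mono) auto
    finally show ?thesis
      by (simp add: mult.commute)
  qed
qed

definition slice_embed :: "complex \<Rightarrow> quat" where
  "slice_embed z = Quat (Re z) (Im z) 0 0"

definition slice_proj :: "quat \<Rightarrow> complex" where
  "slice_proj q = Complex (q0 q) (q1 q)"

lemma slice_embed_power: "slice_embed (z ^ k) = slice_embed z ^ k"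
  by (induction k) (simp_all add: slice_embed_def quat_eq_iff flip: power_Suc2)

lemma norm_slice_embed: "norm (slice_embed z) = norm z"
  by (simp add: slice_embed_def norm_quat_def cmod_def)

lemma slice_embed_add_of_real: "slice_embed (z + of_real t) = slice_embed z + of_real t"
  by (simp add: slice_embed_def quat_eq_iff of_real_def)

text \<open>Left multiplication by the slice preserves both summands of the splitting, so powers of
  \<open>z\<close> on the left pass through the projection.\<close>

lemma slice_proj_embed_mult: "slice_proj (slice_embed z * p) = z * slice_proj p"
  by (simp add: slice_proj_def slice_embed_def complex_eq_iff)

lemma norm_slice_proj_le: "norm (slice_proj q) \<le> norm q"
  by (simp add: slice_proj_def norm_quat_def cmod_def)

lemma slice_proj_1: "slice_proj 1 = 1"
  by (simp add: slice_proj_def complex_eq_iff)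

lemma bounded_linear_slice_proj: "bounded_linear slice_proj"
  by (rule bounded_linear_intro[where K = 1])
    (auto simp: norm_slice_proj_le, auto simp: slice_proj_def complex_eq_iff)

text \<open>\<open>vector_derivative\<close> is a choice that means something only where a
  derivative exists; differentiability of \<open>f\<close> supplies it.\<close>

lemma has_vector_derivative_deriv_x0:
  assumes "f differentiable (at q)"
  shows "((\<lambda>t. f (q + of_real t)) has_vector_derivative deriv_x0 f q) (at 0)"
proof -
  have "(f \<circ> (\<lambda>t. q + of_real t)) differentiable (at (0::real))"
  proof (rule differentiable_chain_at)
    show "(\<lambda>t. q + of_real t) differentiable (at (0::real))"
      by (intro differentiable_add differentiable_const bounded_linear_imp_differentiable
          bounded_linear_of_real)
  qed (use assms in simp)
  then show ?thesis
    by (simp add: deriv_x0_def o_def vector_derivative_works)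
qed

lemma bloch_coeff_le:
  assumes diff: "\<And>q. q \<in> ball 0 1 \<Longrightarrow> f differentiable (at q)"
    and bound: "\<And>q. q \<in> ball 0 1 \<Longrightarrow> (1 - (norm q)\<^sup>2) * norm (deriv_x0 f q) \<le> M"
    and sums: "\<And>q. q \<in> ball 0 1 \<Longrightarrow> (\<lambda>k. q ^ k * a k) sums f q"
    and "0 < n"
  shows "norm (a n) \<le> sqrt (exp 1) * M"
proof (cases "a n = 0")
  case True
  have "0 \<le> M"
    using bound[of 0] by (auto intro: order_trans[OF norm_ge_zero])
  with True show ?thesis by simp
next
  case False
  \<comment> \<open>Projecting \<open>a n\<close> itself could shrink it, even to 0. After
    normalising the coefficient to 1 the projection loses nothing.\<close>
  define b where "b = inverse (a n)"
  define c where "c k = slice_proj (a k * b)" for k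
  define h where "h z = slice_proj (f (slice_embed z) * b)" for z
  have lin: "bounded_linear (\<lambda>q. slice_proj (q * b))"
    by (rule bounded_linear_compose[OF bounded_linear_slice_proj bounded_linear_mult_left])
  have in_ball: "slice_embed z \<in> ball 0 1" if "z \<in> ball 0 1" for z
    using that by (simp add: norm_slice_embed)
  have h_sums: "(\<lambda>k. c k * z ^ k) sums h z" if "z \<in> ball 0 1" for z
    using bounded_linear.sums[OF lin sums[OF in_ball[OF that]]]
    by (simp add: c_def h_def slice_embed_power[symmetric] mult.assoc slice_proj_embed_mult
        mult.commute[of "z ^ _"])
  have "h holomorphic_on ball 0 1"
    using power_series_holomorphic[of 0 1 c h] h_sums by simp
  have h_bound: "(1 - (norm z)\<^sup>2) * norm (deriv h z) \<le> M * norm b" if z: "z \<in> ball 0 1" for z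
  proof -
    \<comment> \<open>Both the complex derivative of \<open>h\<close> and \<open>deriv_x0\<close>
      can be read off along the real direction, so they are compared by differentiating
      \<open>h (z + of_real t)\<close> at \<open>t = 0\<close> in two ways.\<close>
    have "(h has_field_derivative deriv h z) (at z)"
      using \<open>h holomorphic_on ball 0 1\<close> z by (intro holomorphic_derivI) auto
    then have "(h has_field_derivative deriv h z) (at (z + of_real 0))"
      by simp
    moreover have "((\<lambda>t. z + of_real t) has_vector_derivative 1) (at 0)"
      by (auto intro!: derivative_eq_intros)
    ultimately have "(h \<circ> (\<lambda>t. z + of_real t) has_vector_derivative 1 * deriv h z) (at 0)"
      by (intro field_vector_diff_chain_at)
    moreover have "(h \<circ> (\<lambda>t. z + of_real t) has_vector_derivative
        slice_proj (deriv_x0 f (slice_embed z) * b)) (at 0)"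
      using bounded_linear.has_vector_derivative[OF lin
          has_vector_derivative_deriv_x0[OF diff[OF in_ball[OF z]]]]
      by (simp add: o_def h_def slice_embed_add_of_real)
    ultimately have "deriv h z = slice_proj (deriv_x0 f (slice_embed z) * b)"
      by (auto dest: vector_derivative_unique_at)
    then have "norm (deriv h z) \<le> norm (deriv_x0 f (slice_embed z)) * norm b"
      using norm_slice_proj_le by (metis norm_mult)
    moreover have "0 \<le> 1 - (norm z)\<^sup>2"
      using z by (simp add: power_le_one)
    ultimately have "(1 - (norm z)\<^sup>2) * norm (deriv h z)
        \<le> (1 - (norm z)\<^sup>2) * norm (deriv_x0 f (slice_embed z)) * norm b"
      by (simp add: mult_left_mono mult.assoc)
    also have "\<dots> \<le> M * norm b"
      using bound[OF in_ball[OF z]] by (intro mult_right_mono) (simp_all add: norm_slice_embed)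
    finally show ?thesis .
  qed
  have "c n = 1"
    using False by (simp add: c_def b_def slice_proj_1)
  moreover obtain m where "n = Suc m"
    using \<open>0 < n\<close> gr0_implies_Suc by blast
  ultimately have "1 \<le> sqrt (exp 1) * (M * norm b)"
    using power_series_bloch_coeff_le[OF h_sums h_bound, of m] by simp
  moreover have "norm b = 1 / norm (a n)"
    by (simp add: b_def norm_inverse divide_inverse)
  ultimately show ?thesis
    using False by (simp add: pos_le_divide_eq)
qed

lemma sqrt_exp_1_le: "sqrt (exp 1) \<le> exp 1 / sqrt 2"
proof -
  have "sqrt (exp 1) * sqrt 2 \<le> sqrt (exp 1) * sqrt (exp (1::real))"
    using exp_ge_add_one_self[of 1] by (intro mult_left_mono) auto
  then show ?thesis
    by (simp add: pos_le_divide_eq)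
qed

theorem proposition2p19:
  fixes f :: "quat \<Rightarrow> quat" and a :: "nat \<Rightarrow> quat" and n :: nat
  assumes "f \<in> bloch_space"
    and "\<And>q. q \<in> ball 0 1 \<Longrightarrow> (\<lambda>k. q ^ k * a k) sums f q"
  shows "norm (a n) \<le> exp 1 / sqrt 2 * bloch_norm f"
proof -
  define M where "M = (SUP q\<in>ball 0 1. (1 - (norm q)\<^sup>2) * norm (deriv_x0 f q))"
  have norm_eq: "bloch_norm f = norm (f 0) + M"
    by (simp add: bloch_norm_def M_def)
  have diff: "f differentiable (at q)" if "q \<in> ball 0 1" for q
    using assms(1) that by (simp add: bloch_space_def slice_regular_def)
  have bound: "(1 - (norm q)\<^sup>2) * norm (deriv_x0 f q) \<le> M" if "q \<in> ball 0 1" for q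
    unfolding M_def using assms(1) that by (intro cSUP_upper) (auto simp: bloch_space_def)
  have M0: "0 \<le> M"
    using bound[of 0] by (auto intro: order_trans[OF norm_ge_zero])
  have "norm (a n) \<le> sqrt (exp 1) * bloch_norm f"
  proof (cases "n = 0")
    \<comment> \<open>Derivatives do not see \<open>a 0\<close>; it is controlled by the term
      \<open>norm (f 0)\<close> of the Bloch norm. As \<open>0 ^ 0 = 1\<close>, the series at the
      origin is its first term.\<close>
    case True
    have "(\<lambda>k. 0 ^ k * a k) sums a 0"
      using sums_finite[of "{0}" "\<lambda>k. 0 ^ k * a k"] by simp
    then have "a n = f 0"
      using assms(2)[of 0] True sums_unique2 by auto
    then have "norm (a n) \<le> 1 * bloch_norm f"
      using M0 by (simp add: norm_eq)
    also have "\<dots> \<le> sqrt (exp 1) * bloch_norm f"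
      using M0 by (intro mult_right_mono) (auto simp: norm_eq)
    finally show ?thesis .
  next
    case False
    have "norm (a n) \<le> sqrt (exp 1) * M"
      using False by (intro bloch_coeff_le[OF diff bound assms(2)]) auto
    also have "\<dots> \<le> sqrt (exp 1) * bloch_norm f"
      by (simp add: norm_eq)
    finally show ?thesis .
  qed
  also have "\<dots> \<le> exp 1 / sqrt 2 * bloch_norm f"
    using M0 sqrt_exp_1_le by (intro mult_right_mono) (auto simp: norm_eq)
  finally show ?thesis .
qed

end
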